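(* Let $k>4$ and let $G$ be a downward $k$-cycle. Then for every pebbling assignment $(S_G)$ on $G$, $G$ is not isomorphic (as a directed graph) to $[S_G]$.
   Context: A downward $k$-cycle is an oriented graph on $k$ vertices whose underlying undirected graph is a cycle, with exactly one vertex of in-degree $0$ (the top) and exactly one vertex of out-degree $0$ (the bottom); equivalently it is the union of two internally vertex-disjoint directed paths from the top to the bottom. A pebbling assignment $(S_G)$ assigns a nonnegative integer number of pebbles to each vertex. A pebbling move along an edge $(v,w)$ (allowed when $v$ has at least two pebbles) removes two pebbles from $v$ and adds one pebble to $w$. The assignment graph $[S_G]$ is the directed graph whose vertices are all assignments obtainable from $(S_G)$ by finite sequences of pebbling moves (including $(S_G)$ itself), with a directed edge from $A$ to $B$ whenever $B$ is obtained from $A$ by a single pebbling move. *)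

theory Defs
  imports "Graph_Theory.Graph_Theory"
begin

text \<open>Directed graphs without parallel arcs are values of type \<^typ>\<open>'a pair_pre_digraph\<close>;
  \<^const>\<open>with_proj\<close> embeds them into the general digraphs of the library.  The underlying
  undirected graph of \<open>G\<close> is \<^term>\<open>mk_symmetric (with_proj G)\<close>, undirected graphs being
  represented by symmetric arc relations.\<close>

definition oriented_graph :: "'a pair_pre_digraph \<Rightarrow> bool" where
  "oriented_graph G \<longleftrightarrow>
     pair_digraph G \<and> (\<forall>u v. (u, v) \<in> parcs G \<longrightarrow> (v, u) \<notin> parcs G)"

definition undirected_cycle :: "nat \<Rightarrow> 'a pair_pre_digraph \<Rightarrow> bool" where
  "undirected_cycle k H \<longleftrightarrow> 3 \<le> k \<and>
     (\<exists>vs. length vs = k \<and> distinct vs \<and> pverts H = set vs \<and>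
           parcs H = symcl {(vs ! i, vs ! (Suc i mod k)) | i. i < k})"

definition downward_cycle :: "nat \<Rightarrow> 'a pair_pre_digraph \<Rightarrow> bool" where
  "downward_cycle k G \<longleftrightarrow>
     oriented_graph G \<and> undirected_cycle k (mk_symmetric (with_proj G)) \<and>
     (\<exists>!t. t \<in> pverts G \<and> in_degree (with_proj G) t = 0) \<and>
     (\<exists>!b. b \<in> pverts G \<and> out_degree (with_proj G) b = 0)"

text \<open>Functions on the vertex type stand for functions on the vertex set by
  being zero elsewhere.\<close>

definition pebbling_assignment :: "'a pair_pre_digraph \<Rightarrow> ('a \<Rightarrow> nat) \<Rightarrow> bool" where
  "pebbling_assignment G S \<longleftrightarrow> (\<forall>v. v \<notin> pverts G \<longrightarrow> S v = 0)"

definition pebbling_move :: "'a pair_pre_digraph \<Rightarrow> ('a \<Rightarrow> nat) \<Rightarrow> ('a \<Rightarrow> nat) \<Rightarrow> bool" where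
  "pebbling_move G A B \<longleftrightarrow>
     (\<exists>v w. (v, w) \<in> parcs G \<and> 2 \<le> A v \<and> B = A(v := A v - 2, w := A w + 1))"

definition assignment_graph ::
    "'a pair_pre_digraph \<Rightarrow> ('a \<Rightarrow> nat) \<Rightarrow> ('a \<Rightarrow> nat) pair_pre_digraph" where
  "assignment_graph G S =
     \<lparr> pverts = {A. (pebbling_move G)\<^sup>*\<^sup>* S A},
       parcs = {(A, B). (pebbling_move G)\<^sup>*\<^sup>* S A \<and> pebbling_move G A B} \<rparr>"

end

theory Submission
  imports Defs
begin

text \<open>Every vertex of a downward cycle has total degree two, only one vertex is a sink, and
  an isomorphism carries both facts over to \<open>[S]\<close>.  In \<open>[S]\<close> the assignment \<open>S\<close> is a source,
  so exactly two moves are available from it.  If these two moves commute, then \<open>[S]\<close> is a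
  \<open>4\<close>-cycle.  Otherwise both leave the same vertex \<open>v\<close>, a source of \<open>G\<close> holding at most three
  pebbles, so \<open>v\<close> is never used again; one of the two heads has \<open>v\<close> as its only in-neighbour,
  and the parity of the number of its pebbles in the unique final assignment records whether it
  received a pebble from \<open>v\<close> in the first move.\<close>

section \<open>Degrees in downward cycles\<close>

lemma out_degree_with_proj: "out_degree (with_proj G) u = card (parcs G `` {u})"
proof -
  have "out_arcs (with_proj G) u = Pair u ` (parcs G `` {u})"
    by (auto simp: out_arcs_def)
  then show ?thesis
    by (simp add: out_degree_def card_image inj_on_def)
qed

lemma in_degree_with_proj: "in_degree (with_proj G) u = card ((parcs G)\<inverse> `` {u})"
proof -
  have "in_arcs (with_proj G) u = (\<lambda>x. (x, u)) ` ((parcs G)\<inverse> `` {u})"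
    by (auto simp: in_arcs_def)
  then show ?thesis
    by (simp add: in_degree_def card_image inj_on_def)
qed

lemma undirected_cycle_card_verts:
  "undirected_cycle k H \<Longrightarrow> card (pverts H) = k"
  unfolding undirected_cycle_def by (metis distinct_card)

text \<open>The neighbours of \<open>vs ! j\<close> are its cyclic successor and predecessor, which
  are distinct because \<open>3 \<le> k\<close>.\<close>

lemma undirected_cycle_card_neighbours:
  assumes "undirected_cycle k H" and "x \<in> pverts H"
  shows "card (parcs H `` {x}) = 2"
proof -
  from assms obtain vs where k: "3 \<le> k" and len: "length vs = k" and dist: "distinct vs"
    and verts: "pverts H = set vs"
    and arcs: "parcs H = symcl {(vs ! i, vs ! (Suc i mod k)) | i. i < k}"
    unfolding undirected_cycle_def by blast
  from assms(2) obtain j where j: "j < k" "x = vs ! j"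
    using verts len by (metis in_set_conv_nth)
  \<comment> \<open>\<open>p\<close> is the index cyclically before \<open>j\<close>; for
    \<open>j = 0\<close> it wraps around to the last vertex.\<close>
  define p where "p = (if j = 0 then k - 1 else j - 1)"
  have inj: "vs ! a = vs ! b \<longleftrightarrow> a = b" if "a < k" "b < k" for a b
    using dist len that by (simp add: nth_eq_iff_index_eq)
  have sm: "Suc i mod k = (if Suc i = k then 0 else Suc i)" if "i < k" for i
    using that by auto
  have suc: "Suc i mod k < k" for i
    using k by simp
  have pred: "Suc i mod k = j \<longleftrightarrow> i = p" if "i < k" for i
    using that j(1) k by (auto simp: sm p_def)
  have p: "p < k" "Suc j mod k \<noteq> p"
    using j(1) k by (auto simp: sm p_def)
  have arc: "(x, y) \<in> parcs H
      \<longleftrightarrow> (\<exists>i<k. x = vs ! i \<and> y = vs ! (Suc i mod k) \<or> y = vs ! i \<and> x = vs ! (Suc i mod k))" for y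
    unfolding arcs symcl_def by auto
  have "(x, y) \<in> parcs H \<longleftrightarrow> y = vs ! (Suc j mod k) \<or> y = vs ! p" for y
    unfolding arc using inj[OF j(1)] inj[OF j(1) suc] pred p(1) j by metis
  then have "parcs H `` {x} = {vs ! (Suc j mod k), vs ! p}"
    by blast
  then show ?thesis
    using inj[OF suc p(1)] p(2) by simp
qed

lemma downward_cycle_card_verts:
  "downward_cycle k G \<Longrightarrow> card (pverts G) = k"
  unfolding downward_cycle_def using undirected_cycle_card_verts by fastforce

text \<open>An oriented graph never contains an arc together with its reverse, so the in-neighbours
  and the out-neighbours of \<open>x\<close> partition its two neighbours on the underlying
  cycle.\<close>

lemma downward_cycle_degree:
  assumes "downward_cycle k G" and "x \<in> pverts G"
  shows "in_degree (with_proj G) x + out_degree (with_proj G) x = 2"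
proof -
  from assms interpret pair_digraph G
    by (simp add: downward_cycle_def oriented_graph_def)
  have "finite ((parcs G)\<inverse> `` {x})" "finite (parcs G `` {x})"
    by (rule finite_subset[OF _ pair_finite_verts]; use wellformed' in auto)+
  moreover have "(parcs G)\<inverse> `` {x} \<inter> parcs G `` {x} = {}"
    using assms(1) by (auto simp: downward_cycle_def oriented_graph_def)
  moreover have "parcs (mk_symmetric (with_proj G)) `` {x}
      = (parcs G)\<inverse> `` {x} \<union> parcs G `` {x}"
    by (force simp: parcs_mk_symmetric)
  moreover have "card (parcs (mk_symmetric (with_proj G)) `` {x}) = 2"
    using assms by (intro undirected_cycle_card_neighbours) (auto simp: downward_cycle_def)
  ultimately show ?thesis
    by (simp add: in_degree_with_proj out_degree_with_proj card_Un_disjoint)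
qed

section \<open>Pebbling moves on a finite loopless digraph\<close>

context pair_digraph
begin

text \<open>A move destroys one pebble in total, since \<open>v\<close> and \<open>w\<close> differ
  in the absence of loops. The total serves as a termination measure and shows that no move leads
  back to the initial assignment.\<close>

lemma sum_pebbling_move:
  assumes "pebbling_move G A B"
  shows "sum B (pverts G) < sum A (pverts G)"
proof -
  from assms obtain v w where vw: "(v, w) \<in> parcs G" and A: "2 \<le> A v"
    and B: "B = A(v := A v - 2, w := A w + 1)"
    unfolding pebbling_move_def by blast
  have in_verts: "v \<in> pverts G" "w \<in> pverts G - {v}"
    using vw wellformed' pair_no_loops[OF vw] by auto
  have "sum f (pverts G) = f v + (f w + sum f (pverts G - {v} - {w}))" for f :: "'a \<Rightarrow> nat"
    using in_verts pair_finite_verts by (simp add: sum.remove)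
  moreover have "sum B (pverts G - {v} - {w}) = sum A (pverts G - {v} - {w})"
    by (rule sum.cong) (auto simp: B)
  ultimately show ?thesis
    using A in_verts by (auto simp: B)
qed

lemma sum_pebbling_moves:
  "(pebbling_move G)\<^sup>*\<^sup>* A B \<Longrightarrow> sum B (pverts G) \<le> sum A (pverts G)"
  by (induction rule: rtranclp_induct) (auto dest: sum_pebbling_move)

lemma pebbling_moves_terminate:
  "\<exists>E. (pebbling_move G)\<^sup>*\<^sup>* A E \<and> (\<nexists>B. pebbling_move G E B)"
proof (induction "sum A (pverts G)" arbitrary: A rule: less_induct)
  case less
  show ?case
  proof (cases "\<exists>B. pebbling_move G A B")
    case True
    then obtain B where B: "pebbling_move G A B" ..
    from less[OF sum_pebbling_move[OF B]] B show ?thesis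
      by (meson converse_rtranclp_into_rtranclp)
  qed blast
qed

text \<open>A move lowers the count only at its tail. Hence either move stays possible after the
  other: the tails differ, or their common vertex has pebbles for both. The changes are additive, so
  their order is irrelevant.\<close>

lemma pebbling_moves_commute:
  assumes "(v, w) \<in> parcs G" "(v', w') \<in> parcs G" "2 \<le> S v" "2 \<le> S v'"
    and "v \<noteq> v' \<or> 4 \<le> S v"
    and A: "A = S(v := S v - 2, w := S w + 1)" and B: "B = S(v' := S v' - 2, w' := S w' + 1)"
  obtains C where "pebbling_move G A C" "pebbling_move G B C"
proof
  have ne: "v \<noteq> w" "v' \<noteq> w'"
    using pair_no_loops assms(1,2) by fastforce+
  \<comment> \<open>The common result is obtained from \<open>A\<close> by the move along
    \<open>(v', w')\<close>.\<close>
  show "pebbling_move G A (A(v' := A v' - 2, w' := A w' + 1))"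
    unfolding pebbling_move_def using assms ne by (intro exI[of _ v'] exI[of _ w']) auto
  have "A(v' := A v' - 2, w' := A w' + 1) = B(v := B v - 2, w := B w + 1)"
    unfolding A B using assms(3-5) ne by (auto simp: fun_eq_iff)
  then show "pebbling_move G B (A(v' := A v' - 2, w' := A w' + 1))"
    unfolding pebbling_move_def using assms ne by (intro exI[of _ v] exI[of _ w]) auto
qed

text \<open>A source with at most one pebble can neither fire nor gain pebbles. As \<open>w\<close>
  is fed by \<open>v\<close> alone, it can only lose pebbles, two at a time.\<close>

lemma pebbling_moves_parity:
  assumes "(pebbling_move G)\<^sup>*\<^sup>* A E" and "A v \<le> 1"
    and "\<And>u. (u, v) \<notin> parcs G" and "\<And>u. (u, w) \<in> parcs G \<Longrightarrow> u = v"
  shows "E v \<le> 1 \<and> (even (E w) \<longleftrightarrow> even (A w))"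
  using assms(1)
proof (induction rule: rtranclp_induct)
  case base
  show ?case using assms(2) by simp
next
  case (step E F)
  then obtain x y where xy: "(x, y) \<in> parcs G" "2 \<le> E x" "F = E(x := E x - 2, y := E y + 1)"
    unfolding pebbling_move_def by blast
  then have "x \<noteq> v" "y \<noteq> v" "y \<noteq> w"
    using step.IH assms(3,4) by auto
  then show ?case
    using step.IH xy by auto
qed

text \<open>After either move \<open>v\<close> holds at most one pebble, so the parity at
  \<open>w\<close> is frozen: it is that of \<open>S w + 1\<close> in one branch and that of
  \<open>S w\<close> in the other.\<close>

lemma no_common_pebbling_result:
  assumes "(v, w) \<in> parcs G" "(v, w') \<in> parcs G" "w \<noteq> w'" "2 \<le> S v" "S v < 4"
    and "\<And>u. (u, v) \<notin> parcs G" and "\<And>u. (u, w) \<in> parcs G \<Longrightarrow> u = v"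
    and "(pebbling_move G)\<^sup>*\<^sup>* (S(v := S v - 2, w := S w + 1)) E"
    and "(pebbling_move G)\<^sup>*\<^sup>* (S(v := S v - 2, w' := S w' + 1)) E"
  shows False
proof -
  have "v \<noteq> w" "v \<noteq> w'"
    using pair_no_loops assms(1,2) by fastforce+
  then show False
    using pebbling_moves_parity[OF assms(8), of v w] pebbling_moves_parity[OF assms(9), of v w]
      assms(3,5-7) by (auto simp: le_diff_conv)
qed

end

section \<open>The assignment graph as a copy of the cycle\<close>

lemma pverts_assignment_graph [simp]:
  "pverts (assignment_graph G S) = {A. (pebbling_move G)\<^sup>*\<^sup>* S A}"
  by (simp add: assignment_graph_def)

lemma parcs_assignment_graph [simp]:
  "parcs (assignment_graph G S) = {(A, B). (pebbling_move G)\<^sup>*\<^sup>* S A \<and> pebbling_move G A B}"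
  by (simp add: assignment_graph_def)

theorem theorem3p1:
  fixes G :: "'a pair_pre_digraph" and S :: "'a \<Rightarrow> nat" and k :: nat
  assumes "k > 4"
    and "downward_cycle k G"
    and "pebbling_assignment G S"
  shows "\<not> digraph_iso (with_proj G) (with_proj (assignment_graph G S))"
proof
  let ?H = "assignment_graph G S"
  let ?R = "(pebbling_move G)\<^sup>*\<^sup>*"
  assume "digraph_iso (with_proj G) (with_proj ?H)"
  then obtain f where f: "pre_digraph.digraph_isomorphism (with_proj G) f"
    and H: "with_proj ?H = app_iso f (with_proj G)"
    unfolding digraph_iso_def by blast
  interpret pair_digraph G
    using assms(2) by (simp add: downward_cycle_def oriented_graph_def)
  have verts_H: "pverts ?H = iso_verts f ` pverts G"
    using arg_cong[OF H, of verts] by simp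
  have inj: "inj_on (iso_verts f) (pverts G)"
    using digraph_isomorphism_inj_on_verts[OF f] by simp
  have fin_H: "finite (pverts ?H)"
    unfolding verts_H using pair_finite_verts by simp
  have card_H: "card (pverts ?H) = k"
    unfolding verts_H using card_image[OF inj] downward_cycle_card_verts[OF assms(2)] by simp
  have deg_iso: "in_degree (with_proj ?H) (iso_verts f x) = in_degree (with_proj G) x"
    "out_degree (with_proj ?H) (iso_verts f x) = out_degree (with_proj G) x" if "x \<in> pverts G" for x
    unfolding H using in_degree_app_iso_eq[OF f] out_degree_app_iso_eq[OF f] that by simp_all
  \<comment> \<open>Since \<open>card\<close> is 0 on infinite sets, finiteness is what allows small
    degrees to be read as statements about neighbours.\<close>
  have fin_out: "finite {B. pebbling_move G A B}" and fin_in: "finite {B. ?R S B \<and> pebbling_move G B A}"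
    if "?R S A" for A
    by (rule finite_subset[OF _ fin_H]; use that in \<open>auto intro: rtranclp.rtrancl_into_rtrancl\<close>)+
  have out_H: "out_degree (with_proj ?H) A = card {B. pebbling_move G A B}"
    and in_H: "in_degree (with_proj ?H) A = card {B. ?R S B \<and> pebbling_move G B A}"
    if "?R S A" for A
    unfolding out_degree_with_proj in_degree_with_proj
    by (rule arg_cong[where f = card]; use that in auto)+
  have iso_vertE: thesis if "?R S A" "\<And>x. x \<in> pverts G \<Longrightarrow> A = iso_verts f x \<Longrightarrow> thesis" for A thesis
    using that verts_H by (metis imageE mem_Collect_eq pverts_assignment_graph)
  have deg_H: "card {B. ?R S B \<and> pebbling_move G B A} + card {B. pebbling_move G A B} = 2"
    if A: "?R S A" for A
  proof -
    obtain x where "x \<in> pverts G" "A = iso_verts f x"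
      using iso_vertE[OF A] .
    then show ?thesis
      using deg_iso[of x] downward_cycle_degree[OF assms(2), of x] in_H[OF that] out_H[OF that]
      by simp
  qed
  have sink_G: "b = b'" if "b \<in> pverts G" "b' \<in> pverts G" "out_degree (with_proj G) b = 0"
    "out_degree (with_proj G) b' = 0" for b b'
    using assms(2) that unfolding downward_cycle_def by blast
  have sink_H: "E = E'" if E: "?R S E" and E': "?R S E'" and sinks: "\<nexists>B. pebbling_move G E B" "\<nexists>B. pebbling_move G E' B"
    for E E'
  proof -
    obtain x where x: "x \<in> pverts G" "E = iso_verts f x"
      using iso_vertE[OF E] .
    obtain x' where x': "x' \<in> pverts G" "E' = iso_verts f x'"
      using iso_vertE[OF E'] .
    have "out_degree (with_proj G) x = 0" "out_degree (with_proj G) x' = 0"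
      using deg_iso(2)[OF x(1)] deg_iso(2)[OF x'(1)] out_H[OF E] out_H[OF E'] sinks x(2) x'(2)
      by simp_all
    then show ?thesis
      using sink_G x x' by blast
  qed
  \<comment> \<open>No assignment reachable from \<open>S\<close> has more pebbles than
    \<open>S\<close>, whereas a predecessor would need more. All of the degree two of
    \<open>S\<close> is therefore outgoing.\<close>
  have "{B. ?R S B \<and> pebbling_move G B S} = {}"
    using sum_pebbling_move sum_pebbling_moves by fastforce
  then have "card {B. pebbling_move G S B} = 2"
    using deg_H[of S] by (simp del: Collect_empty_eq)
  then obtain A B where succ_S: "{B. pebbling_move G S B} = {A, B}" and "A \<noteq> B"
    by (auto simp: card_2_iff)
  then have SA: "pebbling_move G S A" and SB: "pebbling_move G S B"
    by auto
  then have reach: "?R S A" "?R S B"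
    by auto
  from SA obtain v w where vw: "(v, w) \<in> parcs G" "2 \<le> S v" and A: "A = S(v := S v - 2, w := S w + 1)"
    unfolding pebbling_move_def by blast
  from SB obtain v' w' where vw': "(v', w') \<in> parcs G" "2 \<le> S v'"
    and B: "B = S(v' := S v' - 2, w' := S w' + 1)"
    unfolding pebbling_move_def by blast
  show False
  proof (cases "v \<noteq> v' \<or> 4 \<le> S v")
    case True
    then obtain C where AC: "pebbling_move G A C" and BC: "pebbling_move G B C"
      using pebbling_moves_commute[OF vw(1) vw'(1) vw(2) vw'(2) _ A B] by blast
    then have reach_C: "?R S C"
      using reach by (meson rtranclp.rtrancl_into_rtrancl)
    \<comment> \<open>Having a predecessor uses up one unit of the degree of \<open>X\<close>, which
      leaves at most one successor.\<close>
    have unique_succ: "Y = Z" if "?R S W" "pebbling_move G W X" "pebbling_move G X Y" "pebbling_move G X Z"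
      for W X Y Z
    proof -
      have X: "?R S X"
        using that(1,2) by (meson rtranclp.rtrancl_into_rtrancl)
      have "{B. ?R S B \<and> pebbling_move G B X} \<noteq> {}"
        using that by blast
      then have "card {B. pebbling_move G X B} \<le> 1"
        using deg_H[OF X] fin_in[OF X] card_gt_0_iff[of "{B. ?R S B \<and> pebbling_move G B X}"] by linarith
      then show ?thesis
        using card_le_Suc0_iff_eq[OF fin_out[OF X]] that(3,4) by simp
    qed
    \<comment> \<open>The distinct predecessors \<open>A\<close> and \<open>B\<close> exhaust the
      degree of \<open>C\<close>, so \<open>C\<close> is a sink and the four assignments found so
      far are closed under moves.\<close>
    have "card {A, B} \<le> card {B. ?R S B \<and> pebbling_move G B C}"
      using fin_in[OF reach_C] reach AC BC by (intro card_mono) auto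
    then have "card {D. pebbling_move G C D} = 0"
      using deg_H[OF reach_C] \<open>A \<noteq> B\<close> by simp
    then have sink_C: "\<not> pebbling_move G C D" for D
      using fin_out[OF reach_C] by auto
    have "X \<in> {S, A, B, C}" if "?R S X" for X
      using that
    proof (induction rule: rtranclp_induct)
      case (step X Y)
      then show ?case
        using succ_S unique_succ[OF _ SA AC] unique_succ[OF _ SB BC] sink_C by auto
    qed simp
    then have "pverts ?H \<subseteq> {S, A, B, C}"
      by auto
    then have "card (pverts ?H) \<le> card {S, A, B, C}"
      by (intro card_mono) auto
    also have "\<dots> \<le> 4"
      by (simp add: card_insert_if)
    finally show False
      using card_H assms(1) by simp
  next
    case False
    then have v': "v' = v" and "S v < 4"
      by auto
    with A B \<open>A \<noteq> B\<close> have "w \<noteq> w'"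
      by auto
    have fin_arcs: "finite (parcs G `` {x})" "finite ((parcs G)\<inverse> `` {x})" for x
      by (rule finite_subset[OF _ pair_finite_verts]; use wellformed' in auto)+
    have deg_G: "card ((parcs G)\<inverse> `` {x}) + card (parcs G `` {x}) = 2" if "x \<in> pverts G" for x
      using downward_cycle_degree[OF assms(2) that] by (simp add: in_degree_with_proj out_degree_with_proj)
    \<comment> \<open>The two outgoing arcs exhaust the degree of \<open>v\<close>, which makes it a
      source.\<close>
    have "card {w, w'} \<le> card (parcs G `` {v})"
      using vw vw' v' fin_arcs by (intro card_mono) auto
    then have "2 \<le> card (parcs G `` {v})"
      using \<open>w \<noteq> w'\<close> by simp
    then have "card ((parcs G)\<inverse> `` {v}) = 0"
      using deg_G[OF in_arcsD1[OF vw(1)]] by linarith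
    then have source_v: "(u, v) \<notin> parcs G" for u
      using fin_arcs by auto
    have only_v: "u = v" if "(v, x) \<in> parcs G" "(u, x) \<in> parcs G" "out_degree (with_proj G) x \<noteq> 0" for u x
    proof -
      have "card ((parcs G)\<inverse> `` {x}) \<le> 1"
        using deg_G[OF in_arcsD2[OF that(1)]] that(3) unfolding out_degree_with_proj by linarith
      then show ?thesis
        using card_le_Suc0_iff_eq[OF fin_arcs(2)] that(1,2) by simp
    qed
    \<comment> \<open>Both branches end in sinks of the assignment graph, which has only one; this
      yields a common result.\<close>
    obtain E E' where E: "?R A E" "\<nexists>B. pebbling_move G E B" and E': "?R B E'" "\<nexists>B. pebbling_move G E' B"
      using pebbling_moves_terminate by metis
    then have "E' = E"
      using sink_H reach by (meson rtranclp_trans)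
    note results = E(1)[unfolded A] E'(1)[unfolded B \<open>E' = E\<close> v']
    note arcs = vw(1) vw'(1)[unfolded v']
    \<comment> \<open>The only sink of \<open>G\<close> cannot be both \<open>w\<close> and
      \<open>w'\<close>. A head that is not a sink has in-degree at most one, so it is fed by
      \<open>v\<close> alone; if that head is \<open>w'\<close>, the two branches are
      exchanged.\<close>
    have "out_degree (with_proj G) w \<noteq> 0 \<or> out_degree (with_proj G) w' \<noteq> 0"
      using sink_G[of w w'] arcs wellformed' \<open>w \<noteq> w'\<close> by auto
    then show False
      using no_common_pebbling_result[OF arcs _ vw(2) \<open>S v < 4\<close> source_v _ results]
        no_common_pebbling_result[OF arcs(2,1) _ vw(2) \<open>S v < 4\<close> source_v _ results(2,1)]
        only_v arcs \<open>w \<noteq> w'\<close> by blast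
  qed
qed

end
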